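(* Let $(\mathcal{M},\phi,\xi,\eta,g)$ be a $(2n+1)$-dimensional Riemannian $\Pi$-manifold belonging to one of the main classes $\mathcal{F}_i$ $(i=1,4,5,11)$. Let $\dot{T}(x,y)=\dot{D}_xy-\dot{D}_yx-[x,y]$ be the torsion tensor of the first natural connection $\dot{D}$. Then, for all vector fields $x,y$ on $\mathcal{M}$: \begin{enumerate} \item If $(\mathcal{M},\phi,\xi,\eta,g)\in\mathcal{F}_1$, then $$\dot{T}(x,y)=-\frac{1}{4n}\left\{\theta(\phi y)\phi^2x-\theta(\phi x)\phi^2y+\theta(\phi^2x)\phi y-\theta(\phi^2y)\phi x\right\}.$$ \item If $(\mathcal{M},\phi,\xi,\eta,g)\in\mathcal{F}_4$, then $$\dot{T}(x,y)=\frac{1}{2n}\theta(\xi)\left\{\eta(y)\phi x-\eta(x)\phi y\right\}.$$ \item If $(\mathcal{M},\phi,\xi,\eta,g)\in\mathcal{F}_5$, then $$\dot{T}(x,y)=\frac{1}{2n}\theta^*(\xi)\left\{\eta(y)\phi^2x-\eta(x)\phi^2y\right\}.$$ \item If $(\mathcal{M},\phi,\xi,\eta,g)\in\mathcal{F}_{11}$, then $$\dot{T}(x,y)=\left\{\eta(y)\omega(\phi x)-\eta(x)\omega(\phi y)\right\}\xi.$$ \end{enumerate}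
   Context: A Riemannian $\Pi$-manifold $(\mathcal{M},\phi,\xi,\eta,g)$ is a $(2n+1)$-dimensional smooth manifold $\mathcal{M}$ with a Riemannian metric $g$, a $(1,1)$-tensor field $\phi$, a vector field $\xi$ and a 1-form $\eta$ such that $$\phi\xi=0,\quad \phi^2=I-\eta\otimes\xi,\quad \eta\circ\phi=0,\quad \eta(\xi)=1,\quad \operatorname{tr}\phi=0,\quad g(\phi x,\phi y)=g(x,y)-\eta(x)\eta(y).$$ Consequently $g(\phi x,y)=g(x,\phi y)$ and $g(x,\xi)=\eta(x)$. Let $\nabla$ be the Levi-Civita connection of $g$. The fundamental tensor is $F(x,y,z)=g\bigl((\nabla_x\phi)y,z\bigr)$. The Lee forms are the 1-forms $$\theta=g^{ij}F(e_i,e_j,\cdot),\qquad \theta^*=g^{ij}F(e_i,\phi e_j,\cdot),\qquad \omega=F(\xi,\xi,\cdot),$$ where $\{\xi;e_1,\dots,e_{2n}\}$ is a basis of $T_p\mathcal{M}$ with $\eta(e_i)=0$, $(g^{ij})$ is the inverse matrix of $(g_{ij})$, $g_{ij}=g(e_i,e_j)$, and summation is over $i,j=1,\dots,2n$. The main classes are defined by the following conditions, required for all $x,y,z$: \begin{itemize} \item $\mathcal{F}_1$: $F(x,y,z)=\frac{1}{2n}\bigl\{g(\phi x,\phi y)\theta(\phi^2z)+g(\phi x,\phi z)\theta(\phi^2y)-g(x,\phi y)\theta(\phi z)-g(x,\phi z)\theta(\phi y)\bigr\}$; \item $\mathcal{F}_4$: $F(x,y,z)=\frac{\theta(\xi)}{2n}\bigl\{g(\phi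 x,\phi y)\eta(z)+g(\phi x,\phi z)\eta(y)\bigr\}$; \item $\mathcal{F}_5$: $F(x,y,z)=\frac{\theta^*(\xi)}{2n}\bigl\{g(x,\phi y)\eta(z)+g(x,\phi z)\eta(y)\bigr\}$; \item $\mathcal{F}_{11}$: $F(x,y,z)=\eta(x)\bigl\{\eta(y)\omega(z)+\eta(z)\omega(y)\bigr\}$. \end{itemize} The first natural connection $\dot{D}$ is the affine connection defined by $$\dot{D}_xy=\nabla_xy-\tfrac12\bigl\{(\nabla_x\phi)\phi y-(\nabla_x\eta)(y)\,\xi\bigr\}-\eta(y)\nabla_x\xi.$$ *)

theory Defs
  imports "HOL-Analysis.Analysis" "HOL-Library.Function_Algebras"
begin

section \<open>Pointwise vector space structure on functions\<close>

text \<open>Tangent vectors are real-valued functionals, and vector fields are families of those, so both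
  inherit a real vector space structure from \<^typ>\<open>real\<close>. With these instances \<^const>\<open>span\<close>,
  \<^const>\<open>independent\<close>, \<^const>\<open>subspace\<close> and \<^const>\<open>representation\<close> apply to tangent vectors.\<close>

instantiation "fun" :: (type, scaleR) scaleR
begin

definition scaleR_fun :: "real \<Rightarrow> ('a \<Rightarrow> 'b) \<Rightarrow> 'a \<Rightarrow> 'b" where
  "scaleR_fun r f = (\<lambda>x. r *\<^sub>R f x)"

instance ..

end

lemma scaleR_fun_apply [simp]: "(r *\<^sub>R f) x = r *\<^sub>R f x"
  by (simp add: scaleR_fun_def)

instance "fun" :: (type, real_vector) real_vector
  by standard (auto simp: fun_eq_iff scaleR_add_right scaleR_add_left)


section \<open>Smooth manifolds\<close>

primrec Ck_on :: "nat \<Rightarrow> 'a::euclidean_space set \<Rightarrow> ('a \<Rightarrow> 'b::real_normed_vector) \<Rightarrow> bool" where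
  "Ck_on 0 S f \<longleftrightarrow> continuous_on S f"
| "Ck_on (Suc k) S f \<longleftrightarrow>
     (\<forall>x\<in>S. f differentiable (at x)) \<and> (\<forall>v. Ck_on k S (\<lambda>x. frechet_derivative f (at x) v))"

text \<open>Only meant for open sets \<open>S\<close>, since the derivatives are two-sided.\<close>

definition smooth_on :: "'a::euclidean_space set \<Rightarrow> ('a \<Rightarrow> 'b::real_normed_vector) \<Rightarrow> bool" where
  "smooth_on S f \<longleftrightarrow> (\<forall>k. Ck_on k S f)"

text \<open>A chart is a pair of its domain and its coordinate map, whose values outside the domain are
  irrelevant. The underlying set of a manifold is a whole type, Hausdorff and second countable;
  the smooth structure is given by an atlas (not necessarily maximal) with model space \<open>'e\<close>, so
  that the dimension of the manifold is \<open>DIM('e)\<close>.\<close>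

type_synonym ('m, 'e) chart = "'m set \<times> ('m \<Rightarrow> 'e)"

definition is_chart :: "('m::topological_space, 'e::euclidean_space) chart \<Rightarrow> bool" where
  "is_chart = (\<lambda>(U, c). open U \<and> open (c ` U) \<and> homeomorphism U (c ` U) c (inv_into U c))"

definition smooth_manifold ::
  "('m::{t2_space, second_countable_topology}, 'e::euclidean_space) chart set \<Rightarrow> bool" where
  "smooth_manifold A \<longleftrightarrow>
     (\<Union>(U, c)\<in>A. U) = UNIV \<and>
     (\<forall>C\<in>A. is_chart C) \<and>
     (\<forall>(U, c)\<in>A. \<forall>(V, d)\<in>A. smooth_on (c ` (U \<inter> V)) (d \<circ> inv_into U c))"

definition smooth_fun :: "('m, 'e::euclidean_space) chart set \<Rightarrow> ('m \<Rightarrow> real) set" where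
  "smooth_fun A = {f. \<forall>(U, c)\<in>A. smooth_on (c ` U) (f \<circ> inv_into U c)}"


section \<open>Tangent vectors, vector fields and tensor fields\<close>

text \<open>Tangent vectors at \<open>p\<close> are the derivations at \<open>p\<close> of the algebra of smooth functions. They are
  represented by functionals on all functions, which are normalised to vanish on non-smooth ones.\<close>

type_synonym 'm tvec = "('m \<Rightarrow> real) \<Rightarrow> real"

type_synonym 'm vfield = "'m \<Rightarrow> 'm tvec"

definition tangent_space :: "('m, 'e::euclidean_space) chart set \<Rightarrow> 'm \<Rightarrow> 'm tvec set" where
  "tangent_space A p = {v.
     (\<forall>f. f \<notin> smooth_fun A \<longrightarrow> v f = 0) \<and>
     (\<forall>f\<in>smooth_fun A. \<forall>h\<in>smooth_fun A. v (\<lambda>q. f q + h q) = v f + v h) \<and>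
     (\<forall>f\<in>smooth_fun A. \<forall>r. v (\<lambda>q. r * f q) = r * v f) \<and>
     (\<forall>f\<in>smooth_fun A. \<forall>h\<in>smooth_fun A. v (\<lambda>q. f q * h q) = v f * h p + f p * v h)}"

text \<open>Derivative of a function along a vector field.\<close>

definition dir_deriv :: "'m vfield \<Rightarrow> ('m \<Rightarrow> real) \<Rightarrow> 'm \<Rightarrow> real" where
  "dir_deriv X f = (\<lambda>p. X p f)"

definition vector_fields :: "('m, 'e::euclidean_space) chart set \<Rightarrow> 'm vfield set" where
  "vector_fields A = {X. (\<forall>p. X p \<in> tangent_space A p) \<and>
     (\<forall>f\<in>smooth_fun A. dir_deriv X f \<in> smooth_fun A)}"

definition lie_bracket :: "'m vfield \<Rightarrow> 'm vfield \<Rightarrow> 'm vfield" where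
  "lie_bracket X Y = (\<lambda>p f. X p (dir_deriv Y f) - Y p (dir_deriv X f))"

text \<open>Multiplication of a vector field by a function.\<close>

definition fmult :: "('m \<Rightarrow> real) \<Rightarrow> 'm vfield \<Rightarrow> 'm vfield" (infixr "\<star>" 75) where
  "f \<star> X = (\<lambda>p. f p *\<^sub>R X p)"

text \<open>Tensor fields are families of (multi)linear maps on the tangent spaces; \<open>T \<odot> X\<close> contracts the
  first argument of \<open>T\<close> with \<open>X\<close>, so that \<open>\<phi> \<odot> X\<close> and \<open>\<eta> \<odot> X\<close> are the vector field \<open>\<phi>X\<close> and the
  function \<open>\<eta>(X)\<close>, and \<open>g \<odot> X \<odot> Y\<close> is the function \<open>g(X, Y)\<close>. Smoothness of a tensor field means
  that it takes smooth vector fields to smooth functions or smooth vector fields.\<close>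

definition tapp :: "('m \<Rightarrow> 'v \<Rightarrow> 'w) \<Rightarrow> ('m \<Rightarrow> 'v) \<Rightarrow> 'm \<Rightarrow> 'w" (infixl "\<odot>" 90) where
  "T \<odot> X = (\<lambda>p. T p (X p))"

definition lin_on :: "'v::real_vector set \<Rightarrow> ('v \<Rightarrow> 'w::real_vector) \<Rightarrow> bool" where
  "lin_on V L \<longleftrightarrow> (\<forall>u\<in>V. \<forall>v\<in>V. L (u + v) = L u + L v) \<and> (\<forall>u\<in>V. \<forall>r. L (r *\<^sub>R u) = r *\<^sub>R L u)"

definition one_form ::
  "('m, 'e::euclidean_space) chart set \<Rightarrow> ('m \<Rightarrow> 'm tvec \<Rightarrow> real) \<Rightarrow> bool" where
  "one_form A \<eta> \<longleftrightarrow>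
     (\<forall>p. lin_on (tangent_space A p) (\<eta> p)) \<and>
     (\<forall>X\<in>vector_fields A. \<eta> \<odot> X \<in> smooth_fun A)"

definition endo_field ::
  "('m, 'e::euclidean_space) chart set \<Rightarrow> ('m \<Rightarrow> 'm tvec \<Rightarrow> 'm tvec) \<Rightarrow> bool" where
  "endo_field A \<phi> \<longleftrightarrow>
     (\<forall>p. \<phi> p ` tangent_space A p \<subseteq> tangent_space A p \<and> lin_on (tangent_space A p) (\<phi> p)) \<and>
     (\<forall>X\<in>vector_fields A. \<phi> \<odot> X \<in> vector_fields A)"

definition riemannian_metric ::
  "('m, 'e::euclidean_space) chart set \<Rightarrow> ('m \<Rightarrow> 'm tvec \<Rightarrow> 'm tvec \<Rightarrow> real) \<Rightarrow> bool" where
  "riemannian_metric A g \<longleftrightarrow>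
     (\<forall>p. \<forall>u\<in>tangent_space A p.
        lin_on (tangent_space A p) (g p u) \<and>
        (\<forall>v\<in>tangent_space A p. g p u v = g p v u) \<and>
        (u \<noteq> 0 \<longrightarrow> g p u u > 0)) \<and>
     (\<forall>X\<in>vector_fields A. \<forall>Y\<in>vector_fields A. g \<odot> X \<odot> Y \<in> smooth_fun A)"

definition is_basis :: "'v::real_vector set \<Rightarrow> nat \<Rightarrow> (nat \<Rightarrow> 'v) \<Rightarrow> bool" where
  "is_basis V m b \<longleftrightarrow>
     inj_on b {..<m} \<and> independent (b ` {..<m}) \<and> span (b ` {..<m}) = V"

definition trace_on :: "'v::real_vector set \<Rightarrow> ('v \<Rightarrow> 'v) \<Rightarrow> real" where
  "trace_on V L = (let B = (SOME B. independent B \<and> span B = V)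
     in \<Sum>b\<in>B. representation B (L b) b)"


section \<open>Affine connections\<close>

type_synonym 'm connection = "'m vfield \<Rightarrow> 'm vfield \<Rightarrow> 'm vfield"

definition affine_connection ::
  "('m, 'e::euclidean_space) chart set \<Rightarrow> 'm connection \<Rightarrow> bool" where
  "affine_connection A D \<longleftrightarrow>
     (\<forall>X\<in>vector_fields A. \<forall>Y\<in>vector_fields A. D X Y \<in> vector_fields A) \<and>
     (\<forall>X\<in>vector_fields A. \<forall>X'\<in>vector_fields A. \<forall>Y\<in>vector_fields A.
        D (X + X') Y = D X Y + D X' Y) \<and>
     (\<forall>f\<in>smooth_fun A. \<forall>X\<in>vector_fields A. \<forall>Y\<in>vector_fields A.
        D (f \<star> X) Y = f \<star> D X Y) \<and>
     (\<forall>X\<in>vector_fields A. \<forall>Y\<in>vector_fields A. \<forall>Y'\<in>vector_fields A.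
        D X (Y + Y') = D X Y + D X Y') \<and>
     (\<forall>f\<in>smooth_fun A. \<forall>X\<in>vector_fields A. \<forall>Y\<in>vector_fields A.
        D X (f \<star> Y) = dir_deriv X f \<star> Y + f \<star> D X Y)"

definition torsion :: "'m connection \<Rightarrow> 'm vfield \<Rightarrow> 'm vfield \<Rightarrow> 'm vfield" where
  "torsion D X Y = D X Y - D Y X - lie_bracket X Y"

definition levi_civita ::
  "('m, 'e::euclidean_space) chart set \<Rightarrow> ('m \<Rightarrow> 'm tvec \<Rightarrow> 'm tvec \<Rightarrow> real) \<Rightarrow>
   'm connection \<Rightarrow> bool" where
  "levi_civita A g D \<longleftrightarrow>
     affine_connection A D \<and>
     (\<forall>X\<in>vector_fields A. \<forall>Y\<in>vector_fields A. torsion D X Y = 0) \<and>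
     (\<forall>X\<in>vector_fields A. \<forall>Y\<in>vector_fields A. \<forall>Z\<in>vector_fields A.
        dir_deriv X (g \<odot> Y \<odot> Z) = g \<odot> D X Y \<odot> Z + g \<odot> Y \<odot> D X Z)"

text \<open>The covariant derivatives \<open>(D\<^sub>X \<phi>)Y\<close> and \<open>(D\<^sub>X \<eta>)(Y)\<close>.\<close>

definition cov_endo ::
  "'m connection \<Rightarrow> ('m \<Rightarrow> 'm tvec \<Rightarrow> 'm tvec) \<Rightarrow> 'm vfield \<Rightarrow> 'm vfield \<Rightarrow> 'm vfield" where
  "cov_endo D \<phi> X Y = D X (\<phi> \<odot> Y) - \<phi> \<odot> D X Y"

definition cov_form ::
  "'m connection \<Rightarrow> ('m \<Rightarrow> 'm tvec \<Rightarrow> real) \<Rightarrow> 'm vfield \<Rightarrow> 'm vfield \<Rightarrow> 'm \<Rightarrow> real" where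
  "cov_form D \<eta> X Y = dir_deriv X (\<eta> \<odot> Y) - \<eta> \<odot> D X Y"


section \<open>Riemannian Pi-manifolds\<close>

definition riemannian_Pi_manifold ::
  "('m::{t2_space, second_countable_topology}, 'e::euclidean_space) chart set \<Rightarrow> nat \<Rightarrow>
   ('m \<Rightarrow> 'm tvec \<Rightarrow> 'm tvec) \<Rightarrow> 'm vfield \<Rightarrow> ('m \<Rightarrow> 'm tvec \<Rightarrow> real) \<Rightarrow>
   ('m \<Rightarrow> 'm tvec \<Rightarrow> 'm tvec \<Rightarrow> real) \<Rightarrow> bool" where
  "riemannian_Pi_manifold A n \<phi> \<xi> \<eta> g \<longleftrightarrow>
     smooth_manifold A \<and> DIM('e) = 2 * n + 1 \<and>
     riemannian_metric A g \<and> endo_field A \<phi> \<and> \<xi> \<in> vector_fields A \<and> one_form A \<eta> \<and>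
     (\<forall>p. \<phi> p (\<xi> p) = 0 \<and> \<eta> p (\<xi> p) = 1 \<and> trace_on (tangent_space A p) (\<phi> p) = 0 \<and>
        (\<forall>x\<in>tangent_space A p.
           \<phi> p (\<phi> p x) = x - \<eta> p x *\<^sub>R \<xi> p \<and>
           \<eta> p (\<phi> p x) = 0 \<and>
           (\<forall>y\<in>tangent_space A p. g p (\<phi> p x) (\<phi> p y) = g p x y - \<eta> p x * \<eta> p y)))"

definition fundamental_tensor ::
  "('m \<Rightarrow> 'm tvec \<Rightarrow> 'm tvec) \<Rightarrow> ('m \<Rightarrow> 'm tvec \<Rightarrow> 'm tvec \<Rightarrow> real) \<Rightarrow> 'm connection \<Rightarrow>
   'm vfield \<Rightarrow> 'm vfield \<Rightarrow> 'm vfield \<Rightarrow> 'm \<Rightarrow> real" where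
  "fundamental_tensor \<phi> g D X Y Z = g \<odot> cov_endo D \<phi> X Y \<odot> Z"

text \<open>The fundamental tensor is evaluated on vector fields, so a basis \<open>\<xi>, e\<^sub>1, \<dots>, e\<^sub>2\<^sub>n\<close> of the tangent
  space at \<open>p\<close> is given by (globally defined) vector fields \<open>E 0, \<dots>, E (2n - 1)\<close> whose values at \<open>p\<close>
  are \<open>e\<^sub>1, \<dots>, e\<^sub>2\<^sub>n\<close>. Every tangent vector extends to such a field, and by tensoriality the contractions
  below depend neither on the extensions nor on the basis.\<close>

definition adapted_basis ::
  "('m, 'e::euclidean_space) chart set \<Rightarrow> nat \<Rightarrow> 'm vfield \<Rightarrow> ('m \<Rightarrow> 'm tvec \<Rightarrow> real) \<Rightarrow> 'm \<Rightarrow>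
   (nat \<Rightarrow> 'm vfield) \<Rightarrow> bool" where
  "adapted_basis A n \<xi> \<eta> p E \<longleftrightarrow>
     (\<forall>i<2*n. E i \<in> vector_fields A \<and> \<eta> p (E i p) = 0) \<and>
     is_basis (tangent_space A p) (2*n + 1) (case_nat (\<xi> p) (\<lambda>i. E i p))"

text \<open>Inverse of the matrix of entries \<open>a i j\<close> with \<open>i, j < m\<close>; other entries are irrelevant.\<close>

definition matrix_inverse :: "nat \<Rightarrow> (nat \<Rightarrow> nat \<Rightarrow> real) \<Rightarrow> nat \<Rightarrow> nat \<Rightarrow> real" where
  "matrix_inverse m a = (SOME b. \<forall>i<m. \<forall>j<m. (\<Sum>k<m. a i k * b k j) = (if i = j then 1 else 0))"

definition lee_theta ::
  "('m, 'e::euclidean_space) chart set \<Rightarrow> nat \<Rightarrow> ('m \<Rightarrow> 'm tvec \<Rightarrow> 'm tvec) \<Rightarrow> 'm vfield \<Rightarrow>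
   ('m \<Rightarrow> 'm tvec \<Rightarrow> real) \<Rightarrow> ('m \<Rightarrow> 'm tvec \<Rightarrow> 'm tvec \<Rightarrow> real) \<Rightarrow> 'm connection \<Rightarrow>
   'm vfield \<Rightarrow> 'm \<Rightarrow> real" where
  "lee_theta A n \<phi> \<xi> \<eta> g D Z p =
     (let E = (SOME E. adapted_basis A n \<xi> \<eta> p E);
          ginv = matrix_inverse (2*n) (\<lambda>i j. g p (E i p) (E j p))
      in \<Sum>i<2*n. \<Sum>j<2*n. ginv i j * fundamental_tensor \<phi> g D (E i) (E j) Z p)"

definition lee_theta_star ::
  "('m, 'e::euclidean_space) chart set \<Rightarrow> nat \<Rightarrow> ('m \<Rightarrow> 'm tvec \<Rightarrow> 'm tvec) \<Rightarrow> 'm vfield \<Rightarrow>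
   ('m \<Rightarrow> 'm tvec \<Rightarrow> real) \<Rightarrow> ('m \<Rightarrow> 'm tvec \<Rightarrow> 'm tvec \<Rightarrow> real) \<Rightarrow> 'm connection \<Rightarrow>
   'm vfield \<Rightarrow> 'm \<Rightarrow> real" where
  "lee_theta_star A n \<phi> \<xi> \<eta> g D Z p =
     (let E = (SOME E. adapted_basis A n \<xi> \<eta> p E);
          ginv = matrix_inverse (2*n) (\<lambda>i j. g p (E i p) (E j p))
      in \<Sum>i<2*n. \<Sum>j<2*n. ginv i j * fundamental_tensor \<phi> g D (E i) (\<phi> \<odot> E j) Z p)"

definition lee_omega ::
  "('m \<Rightarrow> 'm tvec \<Rightarrow> 'm tvec) \<Rightarrow> 'm vfield \<Rightarrow> ('m \<Rightarrow> 'm tvec \<Rightarrow> 'm tvec \<Rightarrow> real) \<Rightarrow>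
   'm connection \<Rightarrow> 'm vfield \<Rightarrow> 'm \<Rightarrow> real" where
  "lee_omega \<phi> \<xi> g D Z = fundamental_tensor \<phi> g D \<xi> \<xi> Z"

definition class_F1 ::
  "('m, 'e::euclidean_space) chart set \<Rightarrow> nat \<Rightarrow> ('m \<Rightarrow> 'm tvec \<Rightarrow> 'm tvec) \<Rightarrow> 'm vfield \<Rightarrow>
   ('m \<Rightarrow> 'm tvec \<Rightarrow> real) \<Rightarrow> ('m \<Rightarrow> 'm tvec \<Rightarrow> 'm tvec \<Rightarrow> real) \<Rightarrow> 'm connection \<Rightarrow> bool" where
  "class_F1 A n \<phi> \<xi> \<eta> g D \<longleftrightarrow>
     (let \<theta> = lee_theta A n \<phi> \<xi> \<eta> g D in
      \<forall>x\<in>vector_fields A. \<forall>y\<in>vector_fields A. \<forall>z\<in>vector_fields A. \<forall>p.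
        fundamental_tensor \<phi> g D x y z p = 1 / (2 * real n) *
          ((g \<odot> (\<phi> \<odot> x) \<odot> (\<phi> \<odot> y)) p * \<theta> (\<phi> \<odot> (\<phi> \<odot> z)) p
         + (g \<odot> (\<phi> \<odot> x) \<odot> (\<phi> \<odot> z)) p * \<theta> (\<phi> \<odot> (\<phi> \<odot> y)) p
         - (g \<odot> x \<odot> (\<phi> \<odot> y)) p * \<theta> (\<phi> \<odot> z) p
         - (g \<odot> x \<odot> (\<phi> \<odot> z)) p * \<theta> (\<phi> \<odot> y) p))"

definition class_F4 ::
  "('m, 'e::euclidean_space) chart set \<Rightarrow> nat \<Rightarrow> ('m \<Rightarrow> 'm tvec \<Rightarrow> 'm tvec) \<Rightarrow> 'm vfield \<Rightarrow>
   ('m \<Rightarrow> 'm tvec \<Rightarrow> real) \<Rightarrow> ('m \<Rightarrow> 'm tvec \<Rightarrow> 'm tvec \<Rightarrow> real) \<Rightarrow> 'm connection \<Rightarrow> bool" where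
  "class_F4 A n \<phi> \<xi> \<eta> g D \<longleftrightarrow>
     (let \<theta> = lee_theta A n \<phi> \<xi> \<eta> g D in
      \<forall>x\<in>vector_fields A. \<forall>y\<in>vector_fields A. \<forall>z\<in>vector_fields A. \<forall>p.
        fundamental_tensor \<phi> g D x y z p = \<theta> \<xi> p / (2 * real n) *
          ((g \<odot> (\<phi> \<odot> x) \<odot> (\<phi> \<odot> y)) p * (\<eta> \<odot> z) p
         + (g \<odot> (\<phi> \<odot> x) \<odot> (\<phi> \<odot> z)) p * (\<eta> \<odot> y) p))"

definition class_F5 ::
  "('m, 'e::euclidean_space) chart set \<Rightarrow> nat \<Rightarrow> ('m \<Rightarrow> 'm tvec \<Rightarrow> 'm tvec) \<Rightarrow> 'm vfield \<Rightarrow>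
   ('m \<Rightarrow> 'm tvec \<Rightarrow> real) \<Rightarrow> ('m \<Rightarrow> 'm tvec \<Rightarrow> 'm tvec \<Rightarrow> real) \<Rightarrow> 'm connection \<Rightarrow> bool" where
  "class_F5 A n \<phi> \<xi> \<eta> g D \<longleftrightarrow>
     (let \<theta>s = lee_theta_star A n \<phi> \<xi> \<eta> g D in
      \<forall>x\<in>vector_fields A. \<forall>y\<in>vector_fields A. \<forall>z\<in>vector_fields A. \<forall>p.
        fundamental_tensor \<phi> g D x y z p = \<theta>s \<xi> p / (2 * real n) *
          ((g \<odot> x \<odot> (\<phi> \<odot> y)) p * (\<eta> \<odot> z) p
         + (g \<odot> x \<odot> (\<phi> \<odot> z)) p * (\<eta> \<odot> y) p))"

definition class_F11 ::
  "('m, 'e::euclidean_space) chart set \<Rightarrow> ('m \<Rightarrow> 'm tvec \<Rightarrow> 'm tvec) \<Rightarrow> 'm vfield \<Rightarrow>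
   ('m \<Rightarrow> 'm tvec \<Rightarrow> real) \<Rightarrow> ('m \<Rightarrow> 'm tvec \<Rightarrow> 'm tvec \<Rightarrow> real) \<Rightarrow> 'm connection \<Rightarrow> bool" where
  "class_F11 A \<phi> \<xi> \<eta> g D \<longleftrightarrow>
     (let \<omega> = lee_omega \<phi> \<xi> g D in
      \<forall>x\<in>vector_fields A. \<forall>y\<in>vector_fields A. \<forall>z\<in>vector_fields A. \<forall>p.
        fundamental_tensor \<phi> g D x y z p =
          (\<eta> \<odot> x) p * ((\<eta> \<odot> y) p * \<omega> z p + (\<eta> \<odot> z) p * \<omega> y p))"

definition first_natural_connection ::
  "('m \<Rightarrow> 'm tvec \<Rightarrow> 'm tvec) \<Rightarrow> 'm vfield \<Rightarrow> ('m \<Rightarrow> 'm tvec \<Rightarrow> real) \<Rightarrow>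
   'm connection \<Rightarrow> 'm connection" where
  "first_natural_connection \<phi> \<xi> \<eta> D x y =
     D x y - (1/2) *\<^sub>R (cov_endo D \<phi> x (\<phi> \<odot> y) - cov_form D \<eta> x y \<star> \<xi>) - (\<eta> \<odot> y) \<star> D x \<xi>"

end

theory Submission
  imports Defs
begin

text \<open>The covariant derivative of \<open>\<xi>\<close> is determined by the fundamental tensor through
  \<open>g(\<nabla>\<^sub>x\<xi>, z) = - F(x, \<xi>, \<phi>z)\<close>, because \<open>\<phi>\<xi> = 0\<close> and \<open>g(\<nabla>\<^sub>x\<xi>, \<xi>) = 0\<close>; the derivative of
  \<open>\<eta>\<close> is its metric dual. Since \<open>\<nabla>\<close> is torsion-free, \<open>g(T(x, y), z)\<close> becomes an algebraic expression
  in \<open>F\<close>, into which the defining formulas of the classes are substituted.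

  To conclude by nondegeneracy of \<open>g\<close>, the difference of both sides at a point has to be
  extended to a smooth vector field \<open>z\<close>. Freezing all scalar coefficients at that point does this
  without any smoothness of the Lee forms.\<close>

section \<open>Smoothness of combinations with constant coefficients\<close>

text \<open>The derivatives in \<open>Ck_on\<close> are two-sided and depend only on values near the
  point, so agreement on an open \<open>S\<close> carries over to all of them.\<close>

lemma Ck_on_cong:
  assumes "open S" "\<And>x. x \<in> S \<Longrightarrow> f x = h x" "Ck_on k S f"
  shows "Ck_on k S h"
  using assms(2,3)
proof (induction k arbitrary: f h)
  case 0
  then show ?case
    using continuous_on_eq by auto
next
  case (Suc k)
  have deriv: "(h has_derivative frechet_derivative f (at x)) (at x)" if "x \<in> S" for x
  proof (rule has_derivative_transform_within_open[OF _ \<open>open S\<close> that])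
    show "(f has_derivative frechet_derivative f (at x)) (at x)"
      using Suc.prems(2) that by (simp flip: frechet_derivative_works)
  qed (rule Suc.prems(1))
  have "Ck_on k S (\<lambda>x. frechet_derivative h (at x) v)" for v
  proof (rule Suc.IH)
    show "Ck_on k S (\<lambda>x. frechet_derivative f (at x) v)"
      using Suc.prems(2) by simp
    show "frechet_derivative f (at x) v = frechet_derivative h (at x) v" if "x \<in> S" for x
      using frechet_derivative_at[OF deriv[OF that]] by (rule fun_cong)
  qed
  then show ?case
    using deriv by (auto simp: differentiable_def)
qed

text \<open>Differentiability is known only at points of \<open>S\<close>, so the derivative of the
  combination is the combination of the derivatives only there; the induction step therefore goes
  through \<open>Ck_on_cong\<close>.\<close>

lemma Ck_on_lincomb:
  assumes "open S" "Ck_on k S f" "Ck_on k S h"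
  shows "Ck_on k S (\<lambda>x. a *\<^sub>R f x + b *\<^sub>R h x)"
  using assms(2,3)
proof (induction k arbitrary: f h)
  case 0
  then show ?case
    by (auto intro!: continuous_intros)
next
  case (Suc k)
  have deriv: "((\<lambda>x. a *\<^sub>R f x + b *\<^sub>R h x) has_derivative
      (\<lambda>v. a *\<^sub>R frechet_derivative f (at x) v + b *\<^sub>R frechet_derivative h (at x) v)) (at x)"
    if "x \<in> S" for x
    using Suc.prems that by (auto intro!: derivative_intros simp flip: frechet_derivative_works)
  have "Ck_on k S (\<lambda>x. frechet_derivative (\<lambda>x. a *\<^sub>R f x + b *\<^sub>R h x) (at x) v)" for v
  proof (rule Ck_on_cong[OF \<open>open S\<close>])
    show "Ck_on k S
      (\<lambda>x. a *\<^sub>R frechet_derivative f (at x) v + b *\<^sub>R frechet_derivative h (at x) v)"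
      using Suc by auto
  qed (simp flip: frechet_derivative_at[OF deriv])
  then show ?case
    using deriv by (auto simp: differentiable_def)
qed

lemma smooth_fun_lincomb:
  assumes "smooth_manifold A" "f \<in> smooth_fun A" "h \<in> smooth_fun A"
  shows "(\<lambda>q. a * f q + b * h q) \<in> smooth_fun A"
proof -
  have "smooth_on (c ` U) ((\<lambda>q. a * f q + b * h q) \<circ> inv_into U c)" if "(U, c) \<in> A" for U c
  proof -
    have "open (c ` U)"
      using assms(1) that by (auto simp: smooth_manifold_def is_chart_def)
    moreover have "Ck_on k (c ` U) (\<lambda>q. f (inv_into U c q))"
      "Ck_on k (c ` U) (\<lambda>q. h (inv_into U c q))" for k
      using assms(2,3) that by (auto simp: smooth_fun_def smooth_on_def o_def)
    ultimately have
      "Ck_on k (c ` U) (\<lambda>q. a *\<^sub>R f (inv_into U c q) + b *\<^sub>R h (inv_into U c q))" for k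
      by (intro Ck_on_lincomb)
    then show ?thesis
      by (simp add: smooth_on_def o_def)
  qed
  then show ?thesis
    by (auto simp: smooth_fun_def)
qed

section \<open>Linear structure of tangent vectors and vector fields\<close>

lemma tangent_space_lincomb:
  assumes "u \<in> tangent_space A p" "v \<in> tangent_space A p"
  shows "a *\<^sub>R u + b *\<^sub>R v \<in> tangent_space A p"
  using assms by (simp add: tangent_space_def algebra_simps)

lemma tangent_space_subspace: "subspace (tangent_space A p)"
  unfolding subspace_def
proof (intro conjI ballI allI)
  show "0 \<in> tangent_space A p"
    by (simp add: tangent_space_def)
qed (use tangent_space_lincomb[of _ A p _ 1 1] tangent_space_lincomb[of _ A p _ _ 0] in auto)

text \<open>The Leibniz rule for \<open>1 * 1 = 1\<close> makes the value equal to its own double.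
  Outside \<open>smooth_fun A\<close> the value is zero by the normalisation of tangent
  vectors.\<close>

lemma tangent_vector_const:
  assumes "v \<in> tangent_space A p"
  shows "v (\<lambda>_. 1) = 0"
proof (cases "(\<lambda>_. 1) \<in> smooth_fun A")
  case True
  moreover have "\<forall>f\<in>smooth_fun A. \<forall>h\<in>smooth_fun A. v (\<lambda>q. f q * h q) = v f * h p + f p * v h"
    using assms by (simp add: tangent_space_def)
  ultimately have "v (\<lambda>q. 1 * 1) = v (\<lambda>_. 1) * 1 + 1 * v (\<lambda>_. 1)"
    by fast
  then show ?thesis
    by simp
qed (use assms in \<open>simp add: tangent_space_def\<close>)

lemma vector_fields_tangent: "X \<in> vector_fields A \<Longrightarrow> X p \<in> tangent_space A p"
  by (simp add: vector_fields_def)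

text \<open>Real coefficients are enough for the later use, where coefficient functions are frozen
  at one point.\<close>

lemma vector_fields_lincomb:
  assumes "smooth_manifold A" "X \<in> vector_fields A" "Y \<in> vector_fields A"
  shows "a *\<^sub>R X + b *\<^sub>R Y \<in> vector_fields A"
proof -
  have "dir_deriv (a *\<^sub>R X + b *\<^sub>R Y) f = (\<lambda>q. a * dir_deriv X f q + b * dir_deriv Y f q)" for f
    by (simp add: dir_deriv_def)
  then show ?thesis
    using assms by (auto simp: vector_fields_def tangent_space_lincomb smooth_fun_lincomb)
qed

lemma tapp_apply: "(T \<odot> X) p = T p (X p)"
  by (simp add: tapp_def)

section \<open>Closure properties of vector fields on a Riemannian Pi-manifold\<close>

locale Pi_manifold =
  fixes A :: "('m::{t2_space, second_countable_topology}, 'e::euclidean_space) chart set"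
    and n :: nat
    and \<phi> :: "'m \<Rightarrow> 'm tvec \<Rightarrow> 'm tvec"
    and \<xi> :: "'m vfield"
    and \<eta> :: "'m \<Rightarrow> 'm tvec \<Rightarrow> real"
    and g :: "'m \<Rightarrow> 'm tvec \<Rightarrow> 'm tvec \<Rightarrow> real"
    and nabla :: "'m connection"
  assumes Pi: "riemannian_Pi_manifold A n \<phi> \<xi> \<eta> g"
    and LC: "levi_civita A g nabla"
begin

lemma xi_field: "\<xi> \<in> vector_fields A"
  using Pi by (simp add: riemannian_Pi_manifold_def)

lemma subspace_fields: "subspace (vector_fields A)"
proof -
  have lincomb: "a *\<^sub>R X + b *\<^sub>R Y \<in> vector_fields A"
    if "X \<in> vector_fields A" "Y \<in> vector_fields A" for X Y a b
    using Pi that vector_fields_lincomb by (auto simp: riemannian_Pi_manifold_def)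
  show ?thesis
    unfolding subspace_def
    \<comment> \<open>The zero field is obtained as a combination of \<open>\<xi>\<close> with
      itself, both coefficients being zero.\<close>
    using lincomb[of _ _ 1 1] lincomb[of _ _ _ 0] lincomb[OF xi_field xi_field, of 0 0] by auto
qed

lemmas field_closed = subspace_0[OF subspace_fields] subspace_add[OF subspace_fields]
  subspace_diff[OF subspace_fields] subspace_scale[OF subspace_fields]

lemma phi_field: "X \<in> vector_fields A \<Longrightarrow> \<phi> \<odot> X \<in> vector_fields A"
  using Pi by (simp add: riemannian_Pi_manifold_def endo_field_def)

lemma nabla_field:
  "X \<in> vector_fields A \<Longrightarrow> Y \<in> vector_fields A \<Longrightarrow> nabla X Y \<in> vector_fields A"
  using LC by (simp add: levi_civita_def affine_connection_def)

lemma cov_endo_field: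
  "X \<in> vector_fields A \<Longrightarrow> Y \<in> vector_fields A \<Longrightarrow> cov_endo nabla \<phi> X Y \<in> vector_fields A"
  by (simp add: cov_endo_def field_closed phi_field nabla_field)

lemma nabla_zero: "X \<in> vector_fields A \<Longrightarrow> nabla X 0 = 0"
proof -
  assume "X \<in> vector_fields A"
  then have "nabla X (0 + 0) = nabla X 0 + nabla X 0"
    using LC field_closed(1) unfolding levi_civita_def affine_connection_def by blast
  then show ?thesis
    by simp
qed

section \<open>Pointwise algebra of the structure tensors\<close>

lemmas tangent_closed = subspace_0[OF tangent_space_subspace[of A]]
  subspace_add[OF tangent_space_subspace[of A]]
  subspace_diff[OF tangent_space_subspace[of A]] subspace_scale[OF tangent_space_subspace[of A]]

lemma phi_tangent: "u \<in> tangent_space A p \<Longrightarrow> \<phi> p u \<in> tangent_space A p"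
  using Pi unfolding riemannian_Pi_manifold_def endo_field_def by blast

lemma phi_zero: "\<phi> p 0 = 0"
proof -
  have "\<phi> p (0 *\<^sub>R 0) = 0 *\<^sub>R \<phi> p 0"
    using Pi tangent_closed(1) unfolding riemannian_Pi_manifold_def endo_field_def lin_on_def
    by blast
  then show ?thesis
    by simp
qed

lemma phi_xi: "\<phi> p (\<xi> p) = 0"
  and eta_xi: "\<eta> p (\<xi> p) = 1"
  using Pi by (auto simp: riemannian_Pi_manifold_def)

lemma phi_phi: "u \<in> tangent_space A p \<Longrightarrow> \<phi> p (\<phi> p u) = u - \<eta> p u *\<^sub>R \<xi> p"
  and eta_phi: "u \<in> tangent_space A p \<Longrightarrow> \<eta> p (\<phi> p u) = 0"
  and g_phi_phi: "u \<in> tangent_space A p \<Longrightarrow> v \<in> tangent_space A p \<Longrightarrow>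
    g p (\<phi> p u) (\<phi> p v) = g p u v - \<eta> p u * \<eta> p v"
  using Pi by (auto simp: riemannian_Pi_manifold_def)

lemma g_pos: "u \<in> tangent_space A p \<Longrightarrow> u \<noteq> 0 \<Longrightarrow> g p u u > 0"
  using Pi by (auto simp: riemannian_Pi_manifold_def riemannian_metric_def)

lemma g_sym: "u \<in> tangent_space A p \<Longrightarrow> v \<in> tangent_space A p \<Longrightarrow> g p u v = g p v u"
  using Pi by (auto simp: riemannian_Pi_manifold_def riemannian_metric_def)

lemma g_scale_right: "u \<in> tangent_space A p \<Longrightarrow> v \<in> tangent_space A p \<Longrightarrow>
    g p u (r *\<^sub>R v) = r * g p u v"
  using Pi by (auto simp: riemannian_Pi_manifold_def riemannian_metric_def lin_on_def)

context
  fixes p :: 'm and u v w :: "'m tvec"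
  assumes tangent: "u \<in> tangent_space A p" "v \<in> tangent_space A p" "w \<in> tangent_space A p"
begin

lemma g_add_right: "g p u (v + w) = g p u v + g p u w"
  using Pi tangent by (auto simp: riemannian_Pi_manifold_def riemannian_metric_def lin_on_def)

lemma g_diff_right: "g p u (v - w) = g p u v - g p u w"
proof -
  have "g p u ((v - w) + w) = g p u (v - w) + g p u w"
    using Pi tangent tangent_closed(3)[of v p w]
    unfolding riemannian_Pi_manifold_def riemannian_metric_def lin_on_def by blast
  then show ?thesis
    by simp
qed

end

lemma g_zero_right: "u \<in> tangent_space A p \<Longrightarrow> g p u 0 = 0"
  using g_scale_right[of u p 0 0] tangent_closed(1) by simp

lemma g_add_left: "u \<in> tangent_space A p \<Longrightarrow> v \<in> tangent_space A p \<Longrightarrow> w \<in> tangent_space A p \<Longrightarrow>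
    g p (u + v) w = g p u w + g p v w"
  by (metis g_add_right g_sym tangent_closed(2))

lemma g_diff_left: "u \<in> tangent_space A p \<Longrightarrow> v \<in> tangent_space A p \<Longrightarrow> w \<in> tangent_space A p \<Longrightarrow>
    g p (u - v) w = g p u w - g p v w"
  by (metis g_diff_right g_sym tangent_closed(3))

lemma g_scale_left:
  "u \<in> tangent_space A p \<Longrightarrow> v \<in> tangent_space A p \<Longrightarrow> g p (r *\<^sub>R u) v = r * g p u v"
  by (metis g_scale_right g_sym tangent_closed(4))

lemma g_zero_left: "u \<in> tangent_space A p \<Longrightarrow> g p 0 u = 0"
  by (metis g_zero_right g_sym tangent_closed(1))

lemmas xi_tangent = vector_fields_tangent[OF xi_field]

text \<open>Putting \<open>\<xi>\<close> into the second slot of the compatibility condition kills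
  its left side, since \<open>\<phi>\<close> annihilates \<open>\<xi>\<close>.\<close>

lemma g_xi: "u \<in> tangent_space A p \<Longrightarrow> g p u (\<xi> p) = \<eta> p u"
  using g_phi_phi[OF _ xi_tangent, of u p]
  by (simp add: phi_xi eta_xi g_zero_right[OF phi_tangent] xi_tangent)

lemma g_xi_left: "u \<in> tangent_space A p \<Longrightarrow> g p (\<xi> p) u = \<eta> p u"
  using g_xi g_sym xi_tangent by metis

text \<open>Compatibility is applied to \<open>u\<close> and \<open>\<phi> p v\<close>; then
  \<open>\<phi> p (\<phi> p v)\<close> differs from \<open>v\<close> by a multiple of
  \<open>\<xi> p\<close>, which is orthogonal to the image of \<open>\<phi> p\<close>. As a rewrite
  rule this collects all occurrences of \<open>\<phi>\<close> in the first slot of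
  \<open>g\<close>.\<close>

lemma g_phi_right:
  assumes "u \<in> tangent_space A p" "v \<in> tangent_space A p"
  shows "g p u (\<phi> p v) = g p (\<phi> p u) v"
proof -
  have "g p u (\<phi> p v) = g p (\<phi> p u) (\<phi> p (\<phi> p v))"
    using assms by (simp add: g_phi_phi eta_phi phi_tangent)
  also have "\<dots> = g p (\<phi> p u) v"
    using assms
    by (simp add: phi_phi[of v p] g_diff_right g_scale_right g_xi eta_phi phi_tangent 
        xi_tangent tangent_closed)
  finally show ?thesis .
qed

text \<open>The square of \<open>\<phi>\<close> is the identity on the kernel of
  \<open>\<eta>\<close>, which contains the image of \<open>\<phi>\<close>.\<close>

lemma phi_cubed: "u \<in> tangent_space A p \<Longrightarrow> \<phi> p (\<phi> p (\<phi> p u)) = \<phi> p u"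
  by (simp add: phi_phi[of "\<phi> p u" p] eta_phi phi_tangent)

section \<open>Covariant derivatives of \<open>\<xi>\<close> and \<open>\<eta>\<close>\<close>

lemma metric_compat:
  assumes "X \<in> vector_fields A" "Y \<in> vector_fields A" "Z \<in> vector_fields A"
  shows "X p (g \<odot> Y \<odot> Z) = g p (nabla X Y p) (Z p) + g p (Y p) (nabla X Z p)"
proof -
  have "dir_deriv X (g \<odot> Y \<odot> Z) = g \<odot> nabla X Y \<odot> Z + g \<odot> Y \<odot> nabla X Z"
    using LC assms by (simp add: levi_civita_def)
  then show ?thesis
    by (simp add: fun_eq_iff dir_deriv_def tapp_def)
qed

text \<open>The field \<open>\<xi>\<close> has unit length; differentiating the constant
  \<open>g \<odot> \<xi> \<odot> \<xi>\<close> gives twice the left side.\<close>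

lemma eta_nabla_xi:
  assumes "X \<in> vector_fields A"
  shows "\<eta> p (nabla X \<xi> p) = 0"
proof -
  have "g \<odot> \<xi> \<odot> \<xi> = (\<lambda>_. 1)"
    by (simp add: tapp_def fun_eq_iff g_xi xi_tangent eta_xi)
  then show ?thesis
    using metric_compat[OF assms xi_field xi_field, of p] assms
      tangent_vector_const[OF vector_fields_tangent[OF assms], of p]
    by (simp add: g_xi g_xi_left nabla_field xi_field vector_fields_tangent)
qed

text \<open>Since \<open>\<eta>\<close> is the metric dual of \<open>\<xi>\<close>, differentiating
  \<open>g \<odot> Y \<odot> \<xi>\<close> yields a term that cancels
  \<open>\<eta> \<odot> nabla X Y\<close> and leaves the pairing of \<open>Y\<close> with
  \<open>nabla X \<xi>\<close>.\<close>

lemma cov_form_eta: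
  assumes "X \<in> vector_fields A" "Y \<in> vector_fields A"
  shows "cov_form nabla \<eta> X Y p = g p (nabla X \<xi> p) (Y p)"
proof -
  have "g \<odot> Y \<odot> \<xi> = \<eta> \<odot> Y"
    using assms by (simp add: tapp_def fun_eq_iff g_xi vector_fields_tangent)
  then show ?thesis
    using metric_compat[OF assms xi_field, of p] assms
      g_sym[of "nabla X \<xi> p" p "Y p"]
    by (simp add: cov_form_def dir_deriv_def tapp_def g_xi nabla_field xi_field
        vector_fields_tangent)
qed

text \<open>From \<open>\<phi> \<odot> \<xi> = 0\<close> the derivative of \<open>\<phi>\<close> at
  \<open>\<xi>\<close> is minus \<open>\<phi> \<odot> nabla X \<xi>\<close>. Pairing it with
  \<open>\<phi> \<odot> Z\<close> removes both \<open>\<phi>\<close> by compatibility, as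
  \<open>nabla X \<xi>\<close> lies in the kernel of \<open>\<eta>\<close>.\<close>

lemma g_nabla_xi:
  assumes "X \<in> vector_fields A" "Z \<in> vector_fields A"
  shows "g p (nabla X \<xi> p) (Z p) = - fundamental_tensor \<phi> g nabla X \<xi> (\<phi> \<odot> Z) p"
proof -
  have "\<phi> \<odot> \<xi> = 0"
    by (simp add: tapp_def fun_eq_iff phi_xi)
  then have "cov_endo nabla \<phi> X \<xi> = 0 - \<phi> \<odot> nabla X \<xi>"
    using assms by (simp add: cov_endo_def nabla_zero)
  then have "fundamental_tensor \<phi> g nabla X \<xi> (\<phi> \<odot> Z) p = 
      g p (0 - \<phi> p (nabla X \<xi> p)) (\<phi> p (Z p))"
    by (simp add: fundamental_tensor_def tapp_def)
  also have "\<dots> = - g p (\<phi> p (nabla X \<xi> p)) (\<phi> p (Z p))"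
    using assms by (subst g_diff_left)
      (auto simp: g_zero_left phi_tangent tangent_closed nabla_field xi_field vector_fields_tangent)
  also have "\<dots> = - g p (nabla X \<xi> p) (Z p)"
    using assms eta_nabla_xi[OF assms(1)]
    by (simp add: g_phi_phi nabla_field xi_field vector_fields_tangent)
  finally show ?thesis
    by simp
qed

section \<open>Torsion of the first natural connection\<close>

text \<open>The Lie bracket cancels the antisymmetrised \<open>nabla\<close>, so only the
  antisymmetrised correction terms survive.\<close>

lemma torsion_first_natural:
  assumes "X \<in> vector_fields A" "Y \<in> vector_fields A"
  shows "torsion (first_natural_connection \<phi> \<xi> \<eta> nabla) X Y p =
    (1/2) *\<^sub>R (cov_endo nabla \<phi> Y (\<phi> \<odot> X) p - cov_endo nabla \<phi> X (\<phi> \<odot> Y) p)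
    + ((cov_form nabla \<eta> X Y p - cov_form nabla \<eta> Y X p) / 2) *\<^sub>R \<xi> p
    + (\<eta> p (X p) *\<^sub>R nabla Y \<xi> p - \<eta> p (Y p) *\<^sub>R nabla X \<xi> p)"
proof -
  have "torsion nabla X Y = 0"
    using LC assms by (simp add: levi_civita_def)
  then have "lie_bracket X Y p = nabla X Y p - nabla Y X p"
    unfolding torsion_def by (metis eq_iff_diff_eq_0 minus_apply)
  then show ?thesis
    by (simp add: torsion_def first_natural_connection_def fmult_def tapp_def scaleR_diff_right
        scaleR_diff_left diff_divide_distrib)
qed

text \<open>Each term of the torsion is expressed by \<open>F\<close>: the derivatives of
  \<open>\<eta>\<close> turn into derivatives of \<open>\<xi>\<close> by
  \<open>cov_form_eta\<close>, and these into \<open>F\<close> by \<open>g_nabla_xi\<close>. What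
  remains for each class is algebra.\<close>

lemma g_torsion_first_natural:
  fixes X Y Z :: "'m vfield"
  defines "F \<equiv> fundamental_tensor \<phi> g nabla"
  assumes "X \<in> vector_fields A" "Y \<in> vector_fields A" "Z \<in> vector_fields A"
  shows "g p (torsion (first_natural_connection \<phi> \<xi> \<eta> nabla) X Y p) (Z p) =
    (F Y (\<phi> \<odot> X) Z p - F X (\<phi> \<odot> Y) Z p) / 2
    + (F Y \<xi> (\<phi> \<odot> X) p - F X \<xi> (\<phi> \<odot> Y) p) / 2 * \<eta> p (Z p)
    + \<eta> p (Y p) * F X \<xi> (\<phi> \<odot> Z) p - \<eta> p (X p) * F Y \<xi> (\<phi> \<odot> Z) p"
proof -
  \<comment> \<open>Only the fixed last argument \<open>Z\<close> is unfolded, so the values of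
    \<open>F\<close> coming from \<open>g_nabla_xi\<close>, with last argument in the image of
    \<open>\<phi>\<close>, generally stay atomic.\<close>
  have F: "F U V Z p = g p (cov_endo nabla \<phi> U V p) (Z p)" for U V
    by (simp add: F_def fundamental_tensor_def tapp_def)
  show ?thesis
    unfolding torsion_first_natural[OF assms(2,3)]
    using assms(2-)
    by (simp add: g_add_left g_diff_left g_scale_left g_xi_left tangent_closed cov_endo_field
        nabla_field xi_field phi_field vector_fields_tangent cov_form_eta g_nabla_xi F_def[symmetric] F)
qed

text \<open>The field \<open>R\<close> may depend on \<open>p\<close>, so it can be taken to have coefficients frozen at \<open>p\<close>.\<close>

lemma torsion_first_natural_eqI:
  assumes "X \<in> vector_fields A" "Y \<in> vector_fields A" "R \<in> vector_fields A"
    and "\<And>Z. Z \<in> vector_fields A \<Longrightarrow>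
      g p (torsion (first_natural_connection \<phi> \<xi> \<eta> nabla) X Y p) (Z p) = g p (R p) (Z p)"
  shows "torsion (first_natural_connection \<phi> \<xi> \<eta> nabla) X Y p = R p"
proof -
  let ?T = "torsion (first_natural_connection \<phi> \<xi> \<eta> nabla) X Y p"
  \<comment> \<open>A combination with real coefficients is a vector field by linear closure alone,
    and at \<open>p\<close> it takes the value of the torsion.\<close>
  define W where "W =
    (1/2) *\<^sub>R (cov_endo nabla \<phi> Y (\<phi> \<odot> X) - cov_endo nabla \<phi> X (\<phi> \<odot> Y))
    + ((cov_form nabla \<eta> X Y p - cov_form nabla \<eta> Y X p) / 2) *\<^sub>R \<xi>
    + (\<eta> p (X p) *\<^sub>R nabla Y \<xi> - \<eta> p (Y p) *\<^sub>R nabla X \<xi>)"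
  have W: "W \<in> vector_fields A" "W p = ?T"
    using assms(1,2)
    by (simp_all add: W_def torsion_first_natural field_closed cov_endo_field nabla_field xi_field
        phi_field)
  \<comment> \<open>Testing against the difference itself shows that its length at \<open>p\<close>
    is zero; positive definiteness then applies.\<close>
  have "g p (W p - R p) ((W - R) p) = 0"
    using assms(3) W assms(4)[of "W - R"]
    by (subst g_diff_left) (simp_all add: field_closed tangent_closed vector_fields_tangent flip: W(2))
  then have "W p - R p = 0"
    using g_pos[of "W p - R p" p] assms(3) W(1)
    by (force simp: tangent_closed vector_fields_tangent)
  then show ?thesis
    using W(2) by simp
qed

text \<open>Linearity of \<open>\<theta>\<close> would need the existence of adapted bases; comparing both sides of the
  \<open>F\<^sub>1\<close> condition at \<open>z = 0\<close> makes \<open>\<theta>(0)\<close> harmless without it.\<close>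

lemma theta_zero_F1:
  assumes F1: "class_F1 A n \<phi> \<xi> \<eta> g nabla" and "X \<in> vector_fields A" "Y \<in> vector_fields A"
  shows "1 / (2 * real n) * (lee_theta A n \<phi> \<xi> \<eta> g nabla 0 p *
    (g p (\<phi> p (X p)) (\<phi> p (Y p)) - g p (X p) (\<phi> p (Y p)))) = 0"
proof -
  have "\<phi> \<odot> 0 = 0"
    by (simp add: tapp_def fun_eq_iff phi_zero)
  moreover have "fundamental_tensor \<phi> g nabla X Y 0 p = 0"
    using assms
    by (simp add: fundamental_tensor_def tapp_def g_zero_right vector_fields_tangent
        cov_endo_field)
  ultimately show ?thesis
    using F1 assms(2,3) field_closed(1)
    unfolding class_F1_def Let_def
    by (force simp: tapp_def g_zero_right phi_zero phi_tangent vector_fields_tangent algebra_simps)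
qed

section \<open>Torsion in each of the main classes\<close>

text \<open>All values of \<open>F\<close> at \<open>\<xi>\<close> and a field
  \<open>\<phi> \<odot> W\<close> vanish. In the remaining antisymmetrisation the terms with
  \<open>\<theta>\<close> evaluated on images of \<open>Z\<close> are symmetric in \<open>X\<close>
  and \<open>Y\<close> and cancel.\<close>

lemma torsion_F1:
  fixes X Y :: "'m vfield"
  defines "\<theta> \<equiv> lee_theta A n \<phi> \<xi> \<eta> g nabla"
  assumes F1: "class_F1 A n \<phi> \<xi> \<eta> g nabla"
    and X: "X \<in> vector_fields A" and Y: "Y \<in> vector_fields A"
  shows "torsion (first_natural_connection \<phi> \<xi> \<eta> nabla) X Y = - (1 / (4 * real n)) *\<^sub>R
    (\<theta> (\<phi> \<odot> Y) \<star> (\<phi> \<odot> (\<phi> \<odot> X)) - \<theta> (\<phi> \<odot> X) \<star> (\<phi> \<odot> (\<phi> \<odot> Y))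
     + \<theta> (\<phi> \<odot> (\<phi> \<odot> X)) \<star> (\<phi> \<odot> Y) - \<theta> (\<phi> \<odot> (\<phi> \<odot> Y)) \<star> (\<phi> \<odot> X))"
proof
  fix p
  let ?F = "fundamental_tensor \<phi> g nabla"
  define c where "c = 1 / (2 * real n)"
  define R where "R = - (c / 2) *\<^sub>R
    (\<theta> (\<phi> \<odot> Y) p *\<^sub>R (\<phi> \<odot> (\<phi> \<odot> X)) - \<theta> (\<phi> \<odot> X) p *\<^sub>R (\<phi> \<odot> (\<phi> \<odot> Y))
     + \<theta> (\<phi> \<odot> (\<phi> \<odot> X)) p *\<^sub>R (\<phi> \<odot> Y) - \<theta> (\<phi> \<odot> (\<phi> \<odot> Y)) p *\<^sub>R (\<phi> \<odot> X))"
  have "torsion (first_natural_connection \<phi> \<xi> \<eta> nabla) X Y p = R p"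
  proof (rule torsion_first_natural_eqI[OF X Y])
    show "R \<in> vector_fields A"
      unfolding R_def by (intro field_closed phi_field X Y)
    fix Z assume Z: "Z \<in> vector_fields A"
    \<comment> \<open>The Lee form takes fields as arguments, so identities below
      \<open>\<theta>\<close> have to be equalities of fields and not only of values at
      \<open>p\<close>.\<close>
    have phi3: "\<phi> \<odot> (\<phi> \<odot> (\<phi> \<odot> U)) = \<phi> \<odot> U" if "U \<in> vector_fields A" for U
      using that by (simp add: tapp_apply fun_eq_iff phi_cubed vector_fields_tangent)
    have phi0: "\<phi> \<odot> \<xi> = 0" "\<phi> \<odot> 0 = 0"
      using phi_xi phi_zero by (auto simp: tapp_apply fun_eq_iff)
    have F: "?F U V W p = c *
       (g p (\<phi> p (U p)) (\<phi> p (V p)) * \<theta> (\<phi> \<odot> (\<phi> \<odot> W)) p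
         + g p (\<phi> p (U p)) (\<phi> p (W p)) * \<theta> (\<phi> \<odot> (\<phi> \<odot> V)) p
         - g p (U p) (\<phi> p (V p)) * \<theta> (\<phi> \<odot> W) p
         - g p (U p) (\<phi> p (W p)) * \<theta> (\<phi> \<odot> V) p)"
      if "U \<in> vector_fields A" "V \<in> vector_fields A" "W \<in> vector_fields A" for U V W
      using F1 that by (simp add: class_F1_def Let_def \<theta>_def c_def tapp_apply)
    \<comment> \<open>Every surviving term contains \<open>\<theta>\<close> of the zero field, and
      their sum is the expression that \<open>theta_zero_F1\<close> shows to be zero.\<close>
    have F_xi: "?F U \<xi> (\<phi> \<odot> W) p = 0"
      if "U \<in> vector_fields A" "W \<in> vector_fields A" for U W
      using theta_zero_F1[OF F1 that(1) phi_field[OF that(2)], of p] that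
      by (simp add: F xi_field phi_field phi0 phi_xi g_zero_right phi_tangent tapp_apply
          vector_fields_tangent \<theta>_def c_def algebra_simps)
    have sym: "g p (\<phi> p (Y p)) (X p) = g p (\<phi> p (X p)) (Y p)"
      "g p (\<phi> p (\<phi> p (Y p))) (X p) = g p (\<phi> p (\<phi> p (X p))) (Y p)"
      using X Y by (metis g_phi_right g_sym phi_tangent vector_fields_tangent)+
    have F_phi: "?F Y (\<phi> \<odot> X) Z p - ?F X (\<phi> \<odot> Y) Z p = c *
       (g p (\<phi> p (\<phi> p (Y p))) (Z p) * \<theta> (\<phi> \<odot> X) p
         - g p (\<phi> p (\<phi> p (X p))) (Z p) * \<theta> (\<phi> \<odot> Y) p
         - g p (\<phi> p (Y p)) (Z p) * \<theta> (\<phi> \<odot> (\<phi> \<odot> X)) p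
         + g p (\<phi> p (X p)) (Z p) * \<theta> (\<phi> \<odot> (\<phi> \<odot> Y)) p)"
      using X Y Z sym by (simp add: F phi_field phi3 tapp_apply g_phi_right phi_tangent phi_cubed
          vector_fields_tangent algebra_simps)
    show "g p (torsion (first_natural_connection \<phi> \<xi> \<eta> nabla) X Y p) (Z p) = g p (R p) (Z p)"
      unfolding g_torsion_first_natural[OF X Y Z] R_def F_phi
      \<comment> \<open>The minus sign must stay inside the scalar of \<open>R\<close>, where
        \<open>g_scale_left\<close> can extract it.\<close>
      using X Y Z by (simp add: F_xi g_add_left g_diff_left g_scale_left tangent_closed
          phi_tangent vector_fields_tangent tapp_apply del: scaleR_minus_left)
        (simp add: algebra_simps)
  qed
  then show "torsion (first_natural_connection \<phi> \<xi> \<eta> nabla) X Y p = (- (1 / (4 * real n)) *\<^sub>R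
    (\<theta> (\<phi> \<odot> Y) \<star> (\<phi> \<odot> (\<phi> \<odot> X)) - \<theta> (\<phi> \<odot> X) \<star> (\<phi> \<odot> (\<phi> \<odot> Y))
     + \<theta> (\<phi> \<odot> (\<phi> \<odot> X)) \<star> (\<phi> \<odot> Y) - \<theta> (\<phi> \<odot> (\<phi> \<odot> Y)) \<star> (\<phi> \<odot> X))) p"
    by (simp add: R_def c_def fmult_def)
qed

text \<open>Both \<open>F\<close> at \<open>\<phi> \<odot> Y\<close> and the derivative of
  \<open>\<eta>\<close> are symmetric in the two fields, by self-adjointness of
  \<open>\<phi>\<close>. Only the terms with \<open>nabla X \<xi>\<close> and
  \<open>nabla Y \<xi>\<close> contribute.\<close>

lemma torsion_F4:
  fixes X Y :: "'m vfield"
  defines "\<theta> \<equiv> lee_theta A n \<phi> \<xi> \<eta> g nabla"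
  assumes F4: "class_F4 A n \<phi> \<xi> \<eta> g nabla"
    and X: "X \<in> vector_fields A" and Y: "Y \<in> vector_fields A"
  shows "torsion (first_natural_connection \<phi> \<xi> \<eta> nabla) X Y = (1 / (2 * real n)) *\<^sub>R
    (\<theta> \<xi> \<star> ((\<eta> \<odot> Y) \<star> (\<phi> \<odot> X) - (\<eta> \<odot> X) \<star> (\<phi> \<odot> Y)))"
proof
  fix p
  let ?F = "fundamental_tensor \<phi> g nabla"
  define c where "c = \<theta> \<xi> p / (2 * real n)"
  define R where "R = c *\<^sub>R (\<eta> p (Y p) *\<^sub>R (\<phi> \<odot> X) - \<eta> p (X p) *\<^sub>R (\<phi> \<odot> Y))"
  have "torsion (first_natural_connection \<phi> \<xi> \<eta> nabla) X Y p = R p"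
  proof (rule torsion_first_natural_eqI[OF X Y])
    show "R \<in> vector_fields A"
      unfolding R_def by (intro field_closed phi_field X Y)
    fix Z assume Z: "Z \<in> vector_fields A"
    have F: "?F U V W p = c * (g p (\<phi> p (U p)) (\<phi> p (V p)) * \<eta> p (W p)
        + g p (\<phi> p (U p)) (\<phi> p (W p)) * \<eta> p (V p))"
      if "U \<in> vector_fields A" "V \<in> vector_fields A" "W \<in> vector_fields A" for U V W
      using F4 that by (simp add: class_F4_def Let_def \<theta>_def c_def tapp_apply)
    have F_xi: "?F U \<xi> (\<phi> \<odot> W) p = c * g p (\<phi> p (U p)) (W p)"
      if "U \<in> vector_fields A" "W \<in> vector_fields A" for U W
      using that by (simp add: F xi_field phi_field tapp_apply phi_xi eta_xi g_zero_right g_phi_right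
          phi_tangent phi_cubed vector_fields_tangent)
    have sym: "g p (\<phi> p (Y p)) (X p) = g p (\<phi> p (X p)) (Y p)"
      using X Y by (metis g_phi_right g_sym phi_tangent vector_fields_tangent)
    have F_phi: "?F Y (\<phi> \<odot> X) Z p = ?F X (\<phi> \<odot> Y) Z p"
      using X Y Z sym by (simp add: F phi_field tapp_apply eta_phi g_phi_right phi_tangent phi_cubed
          vector_fields_tangent)
    show "g p (torsion (first_natural_connection \<phi> \<xi> \<eta> nabla) X Y p) (Z p) = g p (R p) (Z p)"
      unfolding g_torsion_first_natural[OF X Y Z] R_def
      using X Y Z sym by (simp add: F_xi F_phi g_diff_left g_scale_left tangent_closed phi_tangent
          vector_fields_tangent tapp_apply algebra_simps)
  qed
  then show "torsion (first_natural_connection \<phi> \<xi> \<eta> nabla) X Y p = ((1 / (2 * real n)) *\<^sub>R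
    (\<theta> \<xi> \<star> ((\<eta> \<odot> Y) \<star> (\<phi> \<odot> X) - (\<eta> \<odot> X) \<star> (\<phi> \<odot> Y)))) p"
    by (simp add: R_def c_def fmult_def tapp_apply)
qed

text \<open>The cancellation is that of class \<open>class_F4\<close>; here \<open>g\<close> pairs
  \<open>x\<close> itself with \<open>\<phi> \<odot> y\<close>, so \<open>nabla X \<xi>\<close> is
  governed by the square of \<open>\<phi>\<close>.\<close>

lemma torsion_F5:
  fixes X Y :: "'m vfield"
  defines "\<theta>s \<equiv> lee_theta_star A n \<phi> \<xi> \<eta> g nabla"
  assumes F5: "class_F5 A n \<phi> \<xi> \<eta> g nabla"
    and X: "X \<in> vector_fields A" and Y: "Y \<in> vector_fields A"
  shows "torsion (first_natural_connection \<phi> \<xi> \<eta> nabla) X Y = (1 / (2 * real n)) *\<^sub>R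
    (\<theta>s \<xi> \<star> ((\<eta> \<odot> Y) \<star> (\<phi> \<odot> (\<phi> \<odot> X)) - (\<eta> \<odot> X) \<star> (\<phi> \<odot> (\<phi> \<odot> Y))))"
proof
  fix p
  let ?F = "fundamental_tensor \<phi> g nabla"
  define c where "c = \<theta>s \<xi> p / (2 * real n)"
  define R where
    "R = c *\<^sub>R (\<eta> p (Y p) *\<^sub>R (\<phi> \<odot> (\<phi> \<odot> X)) - \<eta> p (X p) *\<^sub>R (\<phi> \<odot> (\<phi> \<odot> Y)))"
  have "torsion (first_natural_connection \<phi> \<xi> \<eta> nabla) X Y p = R p"
  proof (rule torsion_first_natural_eqI[OF X Y])
    show "R \<in> vector_fields A"
      unfolding R_def by (intro field_closed phi_field X Y)
    fix Z assume Z: "Z \<in> vector_fields A"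
    have F: "?F U V W p = c * (g p (U p) (\<phi> p (V p)) * \<eta> p (W p)
        + g p (U p) (\<phi> p (W p)) * \<eta> p (V p))"
      if "U \<in> vector_fields A" "V \<in> vector_fields A" "W \<in> vector_fields A" for U V W
      using F5 that by (simp add: class_F5_def Let_def \<theta>s_def c_def tapp_apply)
    have F_xi: "?F U \<xi> (\<phi> \<odot> W) p = c * g p (\<phi> p (\<phi> p (U p))) (W p)"
      if "U \<in> vector_fields A" "W \<in> vector_fields A" for U W
      using that by (simp add: F xi_field phi_field tapp_apply phi_xi eta_xi g_zero_right g_phi_right
          phi_tangent vector_fields_tangent)
    have sym: "g p (\<phi> p (\<phi> p (Y p))) (X p) = g p (\<phi> p (\<phi> p (X p))) (Y p)"
      using X Y by (metis g_phi_right g_sym phi_tangent vector_fields_tangent)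
    have F_phi: "?F Y (\<phi> \<odot> X) Z p = ?F X (\<phi> \<odot> Y) Z p"
      using X Y Z sym by (simp add: F phi_field tapp_apply eta_phi g_phi_right phi_tangent
          vector_fields_tangent)
    show "g p (torsion (first_natural_connection \<phi> \<xi> \<eta> nabla) X Y p) (Z p) = g p (R p) (Z p)"
      unfolding g_torsion_first_natural[OF X Y Z] R_def
      using X Y Z sym by (simp add: F_xi F_phi g_diff_left g_scale_left tangent_closed phi_tangent
          vector_fields_tangent tapp_apply algebra_simps)
  qed
  then show "torsion (first_natural_connection \<phi> \<xi> \<eta> nabla) X Y p = ((1 / (2 * real n)) *\<^sub>R
    (\<theta>s \<xi> \<star> ((\<eta> \<odot> Y) \<star> (\<phi> \<odot> (\<phi> \<odot> X)) - (\<eta> \<odot> X) \<star> (\<phi> \<odot> (\<phi> \<odot> Y))))) p"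
    by (simp add: R_def c_def fmult_def tapp_apply)
qed

text \<open>The derivative of \<open>\<phi>\<close> and that of \<open>\<eta>\<close> each
  contribute half of the result, while the two terms with \<open>\<omega> (\<phi> \<odot> Z)\<close>
  carry the same product of \<open>\<eta>\<close> values and cancel.\<close>

lemma torsion_F11:
  fixes X Y :: "'m vfield"
  defines "\<omega> \<equiv> lee_omega \<phi> \<xi> g nabla"
  assumes F11: "class_F11 A \<phi> \<xi> \<eta> g nabla"
    and X: "X \<in> vector_fields A" and Y: "Y \<in> vector_fields A"
  shows "torsion (first_natural_connection \<phi> \<xi> \<eta> nabla) X Y =
    ((\<eta> \<odot> Y) * \<omega> (\<phi> \<odot> X) - (\<eta> \<odot> X) * \<omega> (\<phi> \<odot> Y)) \<star> \<xi>"
proof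
  fix p
  let ?F = "fundamental_tensor \<phi> g nabla"
  define R where
    "R = (\<eta> p (Y p) * \<omega> (\<phi> \<odot> X) p - \<eta> p (X p) * \<omega> (\<phi> \<odot> Y) p) *\<^sub>R \<xi>"
  have "torsion (first_natural_connection \<phi> \<xi> \<eta> nabla) X Y p = R p"
  proof (rule torsion_first_natural_eqI[OF X Y])
    show "R \<in> vector_fields A"
      unfolding R_def by (intro field_closed xi_field)
    fix Z assume Z: "Z \<in> vector_fields A"
    have F: "?F U V W p = \<eta> p (U p) * (\<eta> p (V p) * \<omega> W p + \<eta> p (W p) * \<omega> V p)"
      if "U \<in> vector_fields A" "V \<in> vector_fields A" "W \<in> vector_fields A" for U V W
      using F11 that by (simp add: class_F11_def Let_def \<omega>_def tapp_apply)
    have F_xi: "?F U \<xi> (\<phi> \<odot> W) p = \<eta> p (U p) * \<omega> (\<phi> \<odot> W) p"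
      and F_phi: "?F U (\<phi> \<odot> W) Z p = \<eta> p (U p) * \<eta> p (Z p) * \<omega> (\<phi> \<odot> W) p"
      if "U \<in> vector_fields A" "W \<in> vector_fields A" for U W
      using that Z by (simp_all add: F xi_field phi_field)
        (simp_all add: tapp_apply eta_phi eta_xi vector_fields_tangent)
    show "g p (torsion (first_natural_connection \<phi> \<xi> \<eta> nabla) X Y p) (Z p) = g p (R p) (Z p)"
      unfolding g_torsion_first_natural[OF X Y Z] R_def
      using X Y Z by (simp add: F_xi F_phi g_scale_left g_xi_left xi_tangent vector_fields_tangent)
        (simp add: field_simps)
  qed
  then show "torsion (first_natural_connection \<phi> \<xi> \<eta> nabla) X Y p =
    (((\<eta> \<odot> Y) * \<omega> (\<phi> \<odot> X) - (\<eta> \<odot> X) * \<omega> (\<phi> \<odot> Y)) \<star> \<xi>) p"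
    by (simp add: R_def fmult_def tapp_apply)
qed

end

theorem theorem4p3:
  fixes A :: "('m::{t2_space, second_countable_topology}, 'e::euclidean_space) chart set"
    and n :: nat
    and \<phi> :: "'m \<Rightarrow> 'm tvec \<Rightarrow> 'm tvec"
    and \<xi> :: "'m vfield"
    and \<eta> :: "'m \<Rightarrow> 'm tvec \<Rightarrow> real"
    and g :: "'m \<Rightarrow> 'm tvec \<Rightarrow> 'm tvec \<Rightarrow> real"
    and nabla :: "'m connection"
    and x y :: "'m vfield"
  assumes "riemannian_Pi_manifold A n \<phi> \<xi> \<eta> g"
    and "levi_civita A g nabla"
    and "x \<in> vector_fields A" and "y \<in> vector_fields A"
  shows "let \<theta> = lee_theta A n \<phi> \<xi> \<eta> g nabla;
             \<theta>s = lee_theta_star A n \<phi> \<xi> \<eta> g nabla;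
             \<omega> = lee_omega \<phi> \<xi> g nabla;
             T = torsion (first_natural_connection \<phi> \<xi> \<eta> nabla)
         in
         (class_F1 A n \<phi> \<xi> \<eta> g nabla \<longrightarrow>
            T x y = - (1 / (4 * real n)) *\<^sub>R
              (\<theta> (\<phi> \<odot> y) \<star> (\<phi> \<odot> (\<phi> \<odot> x)) - \<theta> (\<phi> \<odot> x) \<star> (\<phi> \<odot> (\<phi> \<odot> y))
               + \<theta> (\<phi> \<odot> (\<phi> \<odot> x)) \<star> (\<phi> \<odot> y) - \<theta> (\<phi> \<odot> (\<phi> \<odot> y)) \<star> (\<phi> \<odot> x))) \<and>
         (class_F4 A n \<phi> \<xi> \<eta> g nabla \<longrightarrow>
            T x y = (1 / (2 * real n)) *\<^sub>R
              (\<theta> \<xi> \<star> ((\<eta> \<odot> y) \<star> (\<phi> \<odot> x) - (\<eta> \<odot> x) \<star> (\<phi> \<odot> y)))) \<and>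
         (class_F5 A n \<phi> \<xi> \<eta> g nabla \<longrightarrow>
            T x y = (1 / (2 * real n)) *\<^sub>R
              (\<theta>s \<xi> \<star> ((\<eta> \<odot> y) \<star> (\<phi> \<odot> (\<phi> \<odot> x)) - (\<eta> \<odot> x) \<star> (\<phi> \<odot> (\<phi> \<odot> y))))) \<and>
         (class_F11 A \<phi> \<xi> \<eta> g nabla \<longrightarrow>
            T x y = ((\<eta> \<odot> y) * \<omega> (\<phi> \<odot> x) - (\<eta> \<odot> x) * \<omega> (\<phi> \<odot> y)) \<star> \<xi>)"
proof -
  interpret Pi_manifold A n \<phi> \<xi> \<eta> g nabla
    using assms by unfold_locales
  show ?thesis
    unfolding Let_def using torsion_F1 torsion_F4 torsion_F5 torsion_F11 assms(3,4) by blast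
qed

end
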